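(* Let $R$ be a finite ring with identity. For every vertex $x=(e,u)\in V(Cl_2(R))$, $$\deg_{Cl_2(R)}(x)=\begin{cases}|Id(R)|+O_e\,(|U(R)|-1)-2, & \text{if } u\in U'(R),\\ |Id(R)|+O_e\,(|U(R)|-1)-1, & \text{if } u\in U''(R).\end{cases}$$
   Context: Rings need not be commutative. $Id(R)$ is the set of all idempotents of $R$ (including $0$ and $1$), $U(R)$ is the set of units of $R$, $U'(R)=\{u\in U(R): u^2=1\}$ and $U''(R)=U(R)\setminus U'(R)$. The clean graph $Cl(R)$ is the simple undirected graph with vertex set $Id(R)\times U(R)$, in which two distinct vertices $(e,u)$ and $(f,v)$ are adjacent if and only if $ef=fe=0$ or $uv=vu=1$. $Cl_2(R)$ is the subgraph of $Cl(R)$ induced by $\{(e,u): e\in Id(R)\setminus\{0\},\ u\in U(R)\}$. For $e\in Id(R)$, $O_e:=|\{f\in Id(R)\setminus\{0\}: ef=fe=0\}|$. $\deg_G(v)$ is the number of edges of $G$ incident to $v$. *)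

theory Defs
  imports "HOL-Algebra.Ring"
begin

text \<open>
  A simple undirected graph is a pair of its vertex set and its edge set, every edge being a
  two-element set of vertices.
\<close>

type_synonym 'v ugraph = "'v set \<times> 'v set set"

definition verts :: "'v ugraph \<Rightarrow> 'v set" where
  "verts G = fst G"

definition edges :: "'v ugraph \<Rightarrow> 'v set set" where
  "edges G = snd G"

definition simple_graph :: "'v ugraph \<Rightarrow> bool" where
  "simple_graph G \<longleftrightarrow> (\<forall>E\<in>edges G. E \<subseteq> verts G \<and> card E = 2)"

definition induced_subgraph :: "'v ugraph \<Rightarrow> 'v set \<Rightarrow> 'v ugraph" where
  "induced_subgraph G W = (verts G \<inter> W, {E \<in> edges G. E \<subseteq> W})"

definition degree :: "'v ugraph \<Rightarrow> 'v \<Rightarrow> nat" where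
  "degree G x = card {E \<in> edges G. x \<in> E}"

text \<open>
  Rings are those of \<^locale>\<open>ring\<close>: associative with identity, not necessarily commutative,
  and with the zero ring allowed. The set of units is \<^const>\<open>Units\<close>.
\<close>

definition Id_ring :: "('a, 'm) ring_scheme \<Rightarrow> 'a set" where
  "Id_ring R = {e \<in> carrier R. e \<otimes>\<^bsub>R\<^esub> e = e}"

definition U1_ring :: "('a, 'm) ring_scheme \<Rightarrow> 'a set" where
  "U1_ring R = {u \<in> Units R. u [^]\<^bsub>R\<^esub> (2::nat) = \<one>\<^bsub>R\<^esub>}"

definition U2_ring :: "('a, 'm) ring_scheme \<Rightarrow> 'a set" where
  "U2_ring R = Units R - U1_ring R"

definition orth_count :: "('a, 'm) ring_scheme \<Rightarrow> 'a \<Rightarrow> nat" where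
  "orth_count R e =
     card {f \<in> Id_ring R - {\<zero>\<^bsub>R\<^esub>}. e \<otimes>\<^bsub>R\<^esub> f = \<zero>\<^bsub>R\<^esub> \<and> f \<otimes>\<^bsub>R\<^esub> e = \<zero>\<^bsub>R\<^esub>}"

definition clean_adj :: "('a, 'm) ring_scheme \<Rightarrow> 'a \<times> 'a \<Rightarrow> 'a \<times> 'a \<Rightarrow> bool" where
  "clean_adj R = (\<lambda>(e, u) (f, v).
     (e, u) \<noteq> (f, v) \<and>
     ((e \<otimes>\<^bsub>R\<^esub> f = \<zero>\<^bsub>R\<^esub> \<and> f \<otimes>\<^bsub>R\<^esub> e = \<zero>\<^bsub>R\<^esub>) \<or>
      (u \<otimes>\<^bsub>R\<^esub> v = \<one>\<^bsub>R\<^esub> \<and> v \<otimes>\<^bsub>R\<^esub> u = \<one>\<^bsub>R\<^esub>)))"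

definition clean_graph :: "('a, 'm) ring_scheme \<Rightarrow> ('a \<times> 'a) ugraph" where
  "clean_graph R =
     (Id_ring R \<times> Units R,
      {{x, y} | x y. x \<in> Id_ring R \<times> Units R \<and> y \<in> Id_ring R \<times> Units R \<and> clean_adj R x y})"

definition clean_graph2 :: "('a, 'm) ring_scheme \<Rightarrow> ('a \<times> 'a) ugraph" where
  "clean_graph2 R =
     induced_subgraph (clean_graph R) ((Id_ring R - {\<zero>\<^bsub>R\<^esub>}) \<times> Units R)"

lemma clean_adj_sym: "clean_adj R x y \<Longrightarrow> clean_adj R y x"
  by (auto simp: clean_adj_def)

lemma simple_clean_graph: "simple_graph (clean_graph R)"
  by (auto simp: simple_graph_def clean_graph_def verts_def edges_def clean_adj_def card_2_iff)

lemma simple_induced_subgraph: "simple_graph G \<Longrightarrow> simple_graph (induced_subgraph G W)"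
  by (auto simp: simple_graph_def induced_subgraph_def verts_def edges_def)

lemma simple_clean_graph2: "simple_graph (clean_graph2 R)"
  unfolding clean_graph2_def by (intro simple_induced_subgraph simple_clean_graph)

lemma edges_clean_graph_iff:
  "{x, y} \<in> edges (clean_graph R) \<longleftrightarrow>
     x \<in> verts (clean_graph R) \<and> y \<in> verts (clean_graph R) \<and> clean_adj R x y"
  by (auto simp: clean_graph_def edges_def verts_def doubleton_eq_iff dest: clean_adj_sym)

lemma verts_clean_graph2: "verts (clean_graph2 R) = (Id_ring R - {\<zero>\<^bsub>R\<^esub>}) \<times> Units R"
  by (auto simp: clean_graph2_def induced_subgraph_def clean_graph_def verts_def)

end

theory Submission
  imports Defs
begin

text \<open>
  The neighbours of a vertex \<open>(e, u)\<close> fill some full columns and one full row of the grid of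
  nonzero idempotents against units. Orthogonality depends only on the first coordinate and contributes the block
  \<open>A \<times> Units R\<close>, where \<open>A\<close> is the set of nonzero idempotents orthogonal to \<open>e\<close>; being inverse
  depends only on the second coordinate and contributes the single line at height \<open>inv u\<close>, since
  inverses in a monoid are unique. The block and the line overlap in \<open>|A| = O\<^sub>e\<close> points, so
  their union has \<open>O\<^sub>e |U(R)| + (|Id(R)| - 1) - O\<^sub>e\<close> points.

  The vertex \<open>(e, u)\<close> itself has to be removed from this union if it belongs to it. It never lies in
  the block, because a nonzero idempotent is not orthogonal to itself, and it lies on the line
  exactly when \<open>u = inv u\<close>, that is, when \<open>u\<^sup>2 = 1\<close>. This is the only source of the difference of 1
  between the two cases.
\<close>

text \<open>
  Without loops, an edge at \<open>x\<close> is determined by its other endpoint, so a degree can be computed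
  by counting neighbours instead of edges.
\<close>

lemma degree_eq_card_neighbours:
  assumes "simple_graph G"
  shows "degree G x = card {y. {x, y} \<in> edges G}"
proof -
  have "inj_on (\<lambda>y. {x, y}) {y. {x, y} \<in> edges G}"
    by (auto simp: inj_on_def doubleton_eq_iff)
  then have "card ((\<lambda>y. {x, y}) ` {y. {x, y} \<in> edges G}) = card {y. {x, y} \<in> edges G}"
    by (rule card_image)
  moreover have "(\<lambda>y. {x, y}) ` {y. {x, y} \<in> edges G} = {E \<in> edges G. x \<in> E}"
  proof (intro equalityI subsetI)
    fix E assume E: "E \<in> {E \<in> edges G. x \<in> E}"
    then have "card E = 2"
      using assms by (auto simp: simple_graph_def)
    with E obtain y where "E = {x, y}"
      by (auto simp: card_2_iff)
    with E show "E \<in> (\<lambda>y. {x, y}) ` {y. {x, y} \<in> edges G}"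
      by blast
  qed auto
  ultimately show ?thesis
    by (simp only: degree_def)
qed

lemma edges_clean_graph2_iff:
  "{x, y} \<in> edges (clean_graph2 R) \<longleftrightarrow>
     x \<in> verts (clean_graph2 R) \<and> y \<in> verts (clean_graph2 R) \<and> clean_adj R x y"
proof -
  have "{x, y} \<in> edges (clean_graph2 R) \<longleftrightarrow>
      {x, y} \<in> edges (clean_graph R) \<and> {x, y} \<subseteq> verts (clean_graph2 R)"
    unfolding verts_clean_graph2
    by (auto simp: clean_graph2_def induced_subgraph_def edges_def)
  then show ?thesis
    using edges_clean_graph_iff[of x y R]
    by (auto simp: verts_clean_graph2 clean_graph_def verts_def[of "(_, _)"])
qed

text \<open>
  Inclusion-exclusion for the columns over \<open>A\<close> and the row at height \<open>w\<close>. Counting the row first,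
  each column over \<open>A\<close> adds the \<open>|U| - 1\<close> points off that row; this is the shape of the degree formula.
\<close>

lemma card_block_union_line:
  assumes "finite I" "finite U" "A \<subseteq> I" "w \<in> U"
  shows "int (card (A \<times> U \<union> I \<times> {w})) = int (card I) + int (card A) * (int (card U) - 1)"
proof -
  have fin: "finite A"
    using assms finite_subset by blast
  have "A \<times> U \<inter> I \<times> {w} = A \<times> {w}"
    using assms by auto
  then have "card (A \<times> U) + card (I \<times> {w}) = card (A \<times> U \<union> I \<times> {w}) + card (A \<times> {w})"
    using card_Un_Int[of "A \<times> U" "I \<times> {w}"] assms fin by simp
  then have "card A * card U + card I = card (A \<times> U \<union> I \<times> {w}) + card A"
    by (simp add: card_cartesian_product)
  then have "int (card A) * int (card U) + int (card I) = int (card (A \<times> U \<union> I \<times> {w})) + int (card A)"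
    by (metis of_nat_add of_nat_mult)
  then show ?thesis
    by (simp add: algebra_simps)
qed

context ring
begin

lemma two_sided_inverse_iff:
  assumes "u \<in> Units R" "v \<in> Units R"
  shows "u \<otimes> v = \<one> \<and> v \<otimes> u = \<one> \<longleftrightarrow> v = inv u"
proof
  assume "u \<otimes> v = \<one> \<and> v \<otimes> u = \<one>"
  with assms show "v = inv u"
    by (metis Units_closed inv_char)
next
  assume "v = inv u"
  with assms(1) show "u \<otimes> v = \<one> \<and> v \<otimes> u = \<one>"
    by (simp only: Units_r_inv Units_l_inv simp_thms)
qed

lemma U1_ring_iff:
  assumes "u \<in> Units R"
  shows "u \<in> U1_ring R \<longleftrightarrow> u = inv u"
proof -
  have "u [^] (2::nat) = u \<otimes> u"
    using assms by (simp add: numeral_2_eq_2 Units_closed)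
  then have "u \<in> U1_ring R \<longleftrightarrow> u \<otimes> u = \<one>"
    using assms by (simp only: U1_ring_def mem_Collect_eq simp_thms)
  also have "\<dots> \<longleftrightarrow> u = inv u"
    using two_sided_inverse_iff[OF assms assms] by blast
  finally show ?thesis .
qed

text \<open>
  The two alternatives for adjacency give the block and the line, and the removed point reflects
  that adjacency is restricted to distinct vertices.
\<close>

lemma neighbours_clean_graph2:
  assumes "(e, u) \<in> verts (clean_graph2 R)"
  defines "I \<equiv> Id_ring R - {\<zero>}"
  shows "{y. {(e, u), y} \<in> edges (clean_graph2 R)} =
    ({f \<in> I. e \<otimes> f = \<zero> \<and> f \<otimes> e = \<zero>} \<times> Units R \<union> I \<times> {inv u}) - {(e, u)}"
proof -
  have u: "u \<in> Units R" and inv_u: "inv u \<in> Units R"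
    using assms(1) by (simp_all add: verts_clean_graph2)
  have "(f, v) \<in> {y. {(e, u), y} \<in> edges (clean_graph2 R)} \<longleftrightarrow>
      f \<in> I \<and> v \<in> Units R \<and> (e, u) \<noteq> (f, v) \<and>
        ((e \<otimes> f = \<zero> \<and> f \<otimes> e = \<zero>) \<or> v = inv u)" for f v
    using assms(1) two_sided_inverse_iff[OF u, of v]
    unfolding mem_Collect_eq edges_clean_graph2_iff clean_adj_def I_def verts_clean_graph2
      mem_Sigma_iff prod.case
    by blast
  then have "(f, v) \<in> {y. {(e, u), y} \<in> edges (clean_graph2 R)} \<longleftrightarrow>
      (f, v) \<in> ({f \<in> I. e \<otimes> f = \<zero> \<and> f \<otimes> e = \<zero>} \<times> Units R \<union> I \<times> {inv u}) - {(e, u)}" for f v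
    unfolding Diff_iff Un_iff mem_Sigma_iff mem_Collect_eq singleton_iff
    using inv_u by metis
  then show ?thesis
    by (simp only: set_eq_iff split_paired_All simp_thms)
qed

text \<open>
  Of the subtracted constant, one unit accounts for the idempotent 0, which is absent from the line
  \<open>I \<times> {inv u}\<close>; a second one appears when \<open>(e, u)\<close> itself lies on that line.
\<close>

lemma degree_clean_graph2:
  assumes "finite (carrier R)" and x: "(e, u) \<in> verts (clean_graph2 R)"
  shows "int (degree (clean_graph2 R) (e, u)) =
    int (card (Id_ring R)) + int (orth_count R e) * (int (card (Units R)) - 1)
      - (if u = inv u then 2 else 1)"
proof -
  define I where "I = Id_ring R - {\<zero>}"
  define A where "A = {f \<in> I. e \<otimes> f = \<zero> \<and> f \<otimes> e = \<zero>}"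
  define N where "N = A \<times> Units R \<union> I \<times> {inv u}"
  have e: "e \<in> I" and u: "u \<in> Units R"
    using x by (auto simp: verts_clean_graph2 I_def)
  have fin_Id: "finite (Id_ring R)"
    using assms(1) by (auto simp: Id_ring_def)
  have fin_U: "finite (Units R)"
    using assms(1) by (auto simp: Units_def)
  have "\<zero> \<in> Id_ring R"
    by (simp add: Id_ring_def)
  with fin_Id have card_Id: "card (Id_ring R) = Suc (card I)"
    unfolding I_def by (rule card.remove)
  have "finite I"
    using fin_Id by (simp add: I_def)
  then have card_N: "int (card N) = int (card I) + int (card A) * (int (card (Units R)) - 1)"
    unfolding N_def using fin_U u by (intro card_block_union_line) (auto simp: A_def)
  have "finite N"
    using \<open>finite I\<close> fin_U by (auto simp: N_def A_def)
  \<comment> \<open>Orthogonality of \<open>e\<close> to itself would give \<open>e = e \<otimes> e = \<zero>\<close>.\<close>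
  have "e \<notin> A"
    using e by (auto simp: A_def I_def Id_ring_def)
  then have mem: "(e, u) \<in> N \<longleftrightarrow> u = inv u"
    using e by (auto simp: N_def)
  have "degree (clean_graph2 R) (e, u) = card (N - {(e, u)})"
    using neighbours_clean_graph2[OF x]
    by (simp add: degree_eq_card_neighbours simple_clean_graph2 N_def A_def I_def)
  moreover have "int (card (N - {(e, u)})) = int (card N) - (if u = inv u then 1 else 0)"
    using card.remove[OF \<open>finite N\<close>, of "(e, u)"] mem by auto
  moreover have "orth_count R e = card A"
    by (simp add: orth_count_def A_def I_def)
  ultimately show ?thesis
    using card_N card_Id by simp
qed

end

theorem theorem1:
  fixes R :: "('a, 'm) ring_scheme"
  assumes "ring R" and "finite (carrier R)"
  shows "\<forall>(e, u) \<in> verts (clean_graph2 R).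
    (u \<in> U1_ring R \<longrightarrow>
       int (degree (clean_graph2 R) (e, u)) =
         int (card (Id_ring R)) + int (orth_count R e) * (int (card (Units R)) - 1) - 2) \<and>
    (u \<in> U2_ring R \<longrightarrow>
       int (degree (clean_graph2 R) (e, u)) =
         int (card (Id_ring R)) + int (orth_count R e) * (int (card (Units R)) - 1) - 1)"
proof -
  interpret ring R by fact
  show ?thesis
  proof clarify
    fix e u assume x: "(e, u) \<in> verts (clean_graph2 R)"
    then have u: "u \<in> Units R"
      by (simp add: verts_clean_graph2)
    have "u \<in> U2_ring R \<longleftrightarrow> u \<notin> U1_ring R"
      using u by (simp add: U2_ring_def)
    with degree_clean_graph2[OF assms(2) x] U1_ring_iff[OF u]
    show "(u \<in> U1_ring R \<longrightarrow>
       int (degree (clean_graph2 R) (e, u)) =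
         int (card (Id_ring R)) + int (orth_count R e) * (int (card (Units R)) - 1) - 2) \<and>
      (u \<in> U2_ring R \<longrightarrow>
       int (degree (clean_graph2 R) (e, u)) =
         int (card (Id_ring R)) + int (orth_count R e) * (int (card (Units R)) - 1) - 1)"
      by presburger
  qed
qed

end
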